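(* The sequences of polynomials $\{S_n\}$ and $\{L_n^\alpha\}$ satisfy, for every integer $n\ge1$, $$\rho(x)S_n(x)=F_{2,n}(x)L_n^\alpha(x)+G_{2,n}(x)L_{n-1}^\alpha(x),$$ $$x\left(\rho(x)S_n(x)\right)'=F_{3,n}(x)L_n^\alpha(x)+G_{3,n}(x)L_{n-1}^\alpha(x),$$ where \begin{align*} F_{2,n}(x)&=\rho(x)F_{1,n}(x)=\rho(x)-\sum_{(j,k)\in I_+}\left(\frac{k!\,\lambda_{j,k}S_n^{(k)}(c_j)}{h^\alpha_{n-1}}T_k(x,c_j;L^\alpha_{n-1})\right)\rho_{j,k}(x),\\ G_{2,n}(x)&=\rho(x)G_{1,n}(x)=\sum_{(j,k)\in I_+}\left(\frac{k!\,\lambda_{j,k}S_n^{(k)}(c_j)}{h^\alpha_{n-1}}T_k(x,c_j;L^\alpha_{n})\right)\rho_{j,k}(x),\\ F_{3,n}(x)&=xF_{2,n}'(x)+nF_{2,n}(x)-G_{2,n}(x),\\ G_{3,n}(x)&=xG_{2,n}'(x)+\gamma_nF_{2,n}(x)-(n+\alpha-x)G_{2,n}(x). \end{align*} Here $F_{2,n}$, $G_{2,n}$, $F_{3,n}$ and $G_{3,n}$ are polynomials with the following degrees and leading coefficients: $$\mathrm{DgCo}(F_{2,n})=(d,1),\quad \mathrm{DgCo}(G_{2,n})=(d-1,\sigma_n),\quad \mathrm{DgCo}(F_{3,n})=(d,d+n),\quad \mathrm{DgCo}(G_{3,n})=(d,\gamma_n+\sigma_n),$$ and $$\sigma_n=\frac1{h^\alpha_{n-1}}\sum_{(j,k)\in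 I_+}\lambda_{j,k}S_n^{(k)}(c_j)(L_n^\alpha)^{(k)}(c_j)>0.$$
   Context: Setting. Let $\alpha>-1$, $N\ge 1$, let $c_1,\dots,c_N\in(-\infty,0)$ be distinct, let $0\le d_1\le\cdots\le d_N$ be integers, and let $\lambda_{j,k}\ge 0$ for $1\le j\le N$, $0\le k\le d_j$, with $\lambda_{j,d_j}>0$ for every $j$. Put $I_+=\{(j,k):\lambda_{j,k}>0\}$. On real polynomials define $$\langle f,g\rangle_{\mathsf s}=\int_0^{+\infty}f(x)g(x)x^\alpha e^{-x}\,dx+\sum_{(j,k)\in I_+}\lambda_{j,k}f^{(k)}(c_j)g^{(k)}(c_j).$$ $S_n$ is the monic polynomial of degree $n$ with $\langle S_n,x^k\rangle_{\mathsf s}=0$ for $k=0,\dots,n-1$ (it exists and is unique). $L_n^\alpha$ is the monic Laguerre polynomial of degree $n$, orthogonal with respect to $x^\alpha e^{-x}dx$ on $(0,+\infty)$. Notation. $h_n^\alpha=n!\,\Gamma(n+\alpha+1)$, $\gamma_n=n(n+\alpha)$. $T_k(x,y;f)=\sum_{\nu=0}^k\frac{f^{(\nu)}(y)}{\nu!}(x-y)^\nu$. $\rho(x)=\prod_{j=1}^N(x-c_j)^{d_j+1}$, $d=\sum_{j=1}^N(d_j+1)=\deg\rho$, and $\rho_{j,k}(x)=\rho(x)/(x-c_j)^{k+1}$. The rational functions $F_{1,n}$ and $G_{1,n}$ are $$F_{1,n}(x)=1-\sum_{(j,k)\in I_+}\frac{\lambda_{j,k}k!\,S_n^{(k)}(c_j)}{h^\alpha_{n-1}}\frac{T_k(x,c_j;L^\alpha_{n-1})}{(x-c_j)^{k+1}},\qquad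 G_{1,n}(x)=\sum_{(j,k)\in I_+}\frac{\lambda_{j,k}k!\,S_n^{(k)}(c_j)}{h^\alpha_{n-1}}\frac{T_k(x,c_j;L^\alpha_{n})}{(x-c_j)^{k+1}}.$$ For a polynomial $p$ of degree $m$ with leading coefficient $a$, $\mathrm{DgCo}(p)=(m,a)$.
   Formalization: The claims DgCo(G_{2,n})=(d-1,σ_n) and σ_n>0 are stated only when some (j,k) in I_+ has k≤n; if all k>n then S_n^{(k)}(c_j)=0, so σ_n=0 and G_{2,n}=0 (e.g. N=1, d_1=2, I_+={(1,2)}, n=1). *)

theory Defs
  imports
    "HOL-Analysis.Analysis"
    "HOL-Computational_Algebra.Computational_Algebra"
begin

text \<open>
  Parameters: \<open>\<alpha>\<close>, \<open>N\<close>, the mass points \<open>c j\<close>, the derivative orders \<open>d j\<close> and the masses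
  \<open>lam j k\<close>. Only indices \<open>1 \<le> j \<le> N\<close> and \<open>k \<le> d j\<close> are ever used; values of
  \<open>c\<close>, \<open>d\<close>, \<open>lam\<close> elsewhere are irrelevant.
\<close>

definition I_plus :: "nat \<Rightarrow> (nat \<Rightarrow> nat) \<Rightarrow> (nat \<Rightarrow> nat \<Rightarrow> real) \<Rightarrow> (nat \<times> nat) set" where
  "I_plus N d lam = {(j, k). 1 \<le> j \<and> j \<le> N \<and> k \<le> d j \<and> lam j k > 0}"

definition laguerre_ip :: "real \<Rightarrow> real poly \<Rightarrow> real poly \<Rightarrow> real" where
  "laguerre_ip \<alpha> f g = (LBINT x:{0<..}. poly f x * poly g x * (x powr \<alpha> * exp (- x)))"

definition sobolev_ip ::
  "real \<Rightarrow> nat \<Rightarrow> (nat \<Rightarrow> real) \<Rightarrow> (nat \<Rightarrow> nat) \<Rightarrow> (nat \<Rightarrow> nat \<Rightarrow> real) \<Rightarrow> real poly \<Rightarrow> real poly \<Rightarrow> real"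
where
  "sobolev_ip \<alpha> N c d lam f g = laguerre_ip \<alpha> f g +
     (\<Sum>(j, k) \<in> I_plus N d lam.
        lam j k * poly ((pderiv ^^ k) f) (c j) * poly ((pderiv ^^ k) g) (c j))"

text \<open>
  The description below is proper whenever the bilinear form \<open>ip\<close> is positive definite on
  polynomials, which is the case for both forms above when \<open>\<alpha> > - 1\<close>.
\<close>

definition monic_op :: "(real poly \<Rightarrow> real poly \<Rightarrow> real) \<Rightarrow> nat \<Rightarrow> real poly" where
  "monic_op ip n =
     (THE p. degree p = n \<and> lead_coeff p = 1 \<and> (\<forall>k<n. ip p (monom 1 k) = 0))"

definition laguerre :: "real \<Rightarrow> nat \<Rightarrow> real poly" where
  "laguerre \<alpha> n = monic_op (laguerre_ip \<alpha>) n"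

definition sobolev ::
  "real \<Rightarrow> nat \<Rightarrow> (nat \<Rightarrow> real) \<Rightarrow> (nat \<Rightarrow> nat) \<Rightarrow> (nat \<Rightarrow> nat \<Rightarrow> real) \<Rightarrow> nat \<Rightarrow> real poly"
where
  "sobolev \<alpha> N c d lam n = monic_op (sobolev_ip \<alpha> N c d lam) n"

definition h :: "real \<Rightarrow> nat \<Rightarrow> real" where
  "h \<alpha> n = fact n * Gamma (real n + \<alpha> + 1)"

definition gam :: "real \<Rightarrow> nat \<Rightarrow> real" where
  "gam \<alpha> n = real n * (real n + \<alpha>)"

definition taylor_poly :: "nat \<Rightarrow> real \<Rightarrow> real poly \<Rightarrow> real poly" where
  "taylor_poly k y f = (\<Sum>\<nu>\<le>k. smult (poly ((pderiv ^^ \<nu>) f) y / fact \<nu>) ([:- y, 1:] ^ \<nu>))"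

definition rho :: "nat \<Rightarrow> (nat \<Rightarrow> real) \<Rightarrow> (nat \<Rightarrow> nat) \<Rightarrow> real poly" where
  "rho N c d = (\<Prod>j = 1..N. [:- c j, 1:] ^ (d j + 1))"

definition dtot :: "nat \<Rightarrow> (nat \<Rightarrow> nat) \<Rightarrow> nat" where
  "dtot N d = (\<Sum>j = 1..N. d j + 1)"

text \<open>For \<open>1 \<le> j \<le> N\<close> and \<open>k \<le> d j\<close> the following polynomial division is exact.\<close>

definition rho_jk :: "nat \<Rightarrow> (nat \<Rightarrow> real) \<Rightarrow> (nat \<Rightarrow> nat) \<Rightarrow> nat \<Rightarrow> nat \<Rightarrow> real poly" where
  "rho_jk N c d j k = rho N c d div [:- c j, 1:] ^ (k + 1)"

definition mass_coeff ::
  "real \<Rightarrow> nat \<Rightarrow> (nat \<Rightarrow> real) \<Rightarrow> (nat \<Rightarrow> nat) \<Rightarrow> (nat \<Rightarrow> nat \<Rightarrow> real) \<Rightarrow> nat \<Rightarrow> nat \<Rightarrow> nat \<Rightarrow> real"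
where
  "mass_coeff \<alpha> N c d lam n j k =
     lam j k * fact k * poly ((pderiv ^^ k) (sobolev \<alpha> N c d lam n)) (c j) / h \<alpha> (n - 1)"

text \<open>Rational functions are elements of the fraction field of \<^typ>\<open>real poly\<close>.\<close>

definition F1 ::
  "real \<Rightarrow> nat \<Rightarrow> (nat \<Rightarrow> real) \<Rightarrow> (nat \<Rightarrow> nat) \<Rightarrow> (nat \<Rightarrow> nat \<Rightarrow> real) \<Rightarrow> nat \<Rightarrow> real poly fract"
where
  "F1 \<alpha> N c d lam n = 1 - (\<Sum>(j, k) \<in> I_plus N d lam.
     Fract (smult (mass_coeff \<alpha> N c d lam n j k) (taylor_poly k (c j) (laguerre \<alpha> (n - 1))))
           ([:- c j, 1:] ^ (k + 1)))"

definition G1 ::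
  "real \<Rightarrow> nat \<Rightarrow> (nat \<Rightarrow> real) \<Rightarrow> (nat \<Rightarrow> nat) \<Rightarrow> (nat \<Rightarrow> nat \<Rightarrow> real) \<Rightarrow> nat \<Rightarrow> real poly fract"
where
  "G1 \<alpha> N c d lam n = (\<Sum>(j, k) \<in> I_plus N d lam.
     Fract (smult (mass_coeff \<alpha> N c d lam n j k) (taylor_poly k (c j) (laguerre \<alpha> n)))
           ([:- c j, 1:] ^ (k + 1)))"

definition F2 ::
  "real \<Rightarrow> nat \<Rightarrow> (nat \<Rightarrow> real) \<Rightarrow> (nat \<Rightarrow> nat) \<Rightarrow> (nat \<Rightarrow> nat \<Rightarrow> real) \<Rightarrow> nat \<Rightarrow> real poly"
where
  "F2 \<alpha> N c d lam n = rho N c d - (\<Sum>(j, k) \<in> I_plus N d lam.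
     smult (mass_coeff \<alpha> N c d lam n j k) (taylor_poly k (c j) (laguerre \<alpha> (n - 1)))
       * rho_jk N c d j k)"

definition G2 ::
  "real \<Rightarrow> nat \<Rightarrow> (nat \<Rightarrow> real) \<Rightarrow> (nat \<Rightarrow> nat) \<Rightarrow> (nat \<Rightarrow> nat \<Rightarrow> real) \<Rightarrow> nat \<Rightarrow> real poly"
where
  "G2 \<alpha> N c d lam n = (\<Sum>(j, k) \<in> I_plus N d lam.
     smult (mass_coeff \<alpha> N c d lam n j k) (taylor_poly k (c j) (laguerre \<alpha> n))
       * rho_jk N c d j k)"

definition F3 ::
  "real \<Rightarrow> nat \<Rightarrow> (nat \<Rightarrow> real) \<Rightarrow> (nat \<Rightarrow> nat) \<Rightarrow> (nat \<Rightarrow> nat \<Rightarrow> real) \<Rightarrow> nat \<Rightarrow> real poly"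
where
  "F3 \<alpha> N c d lam n =
     [:0, 1:] * pderiv (F2 \<alpha> N c d lam n) + smult (real n) (F2 \<alpha> N c d lam n) - G2 \<alpha> N c d lam n"

definition G3 ::
  "real \<Rightarrow> nat \<Rightarrow> (nat \<Rightarrow> real) \<Rightarrow> (nat \<Rightarrow> nat) \<Rightarrow> (nat \<Rightarrow> nat \<Rightarrow> real) \<Rightarrow> nat \<Rightarrow> real poly"
where
  "G3 \<alpha> N c d lam n =
     [:0, 1:] * pderiv (G2 \<alpha> N c d lam n) + smult (gam \<alpha> n) (F2 \<alpha> N c d lam n)
       - [:real n + \<alpha>, - 1:] * G2 \<alpha> N c d lam n"

text \<open>
  If all \<open>(j, k) \<in> I_plus N d lam\<close> have \<open>k > n\<close>, then \<open>sobolev\<close> and \<open>laguerre\<close> agree in degree \<open>n\<close>,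
  so that \<open>sigma_n = 0\<close> and \<open>G2 = 0\<close>; otherwise \<open>sigma_n > 0\<close>.
\<close>

definition sigma_n ::
  "real \<Rightarrow> nat \<Rightarrow> (nat \<Rightarrow> real) \<Rightarrow> (nat \<Rightarrow> nat) \<Rightarrow> (nat \<Rightarrow> nat \<Rightarrow> real) \<Rightarrow> nat \<Rightarrow> real"
where
  "sigma_n \<alpha> N c d lam n = (1 / h \<alpha> (n - 1)) * (\<Sum>(j, k) \<in> I_plus N d lam.
     lam j k * poly ((pderiv ^^ k) (sobolev \<alpha> N c d lam n)) (c j)
             * poly ((pderiv ^^ k) (laguerre \<alpha> n)) (c j))"

definition DgCo :: "real poly \<Rightarrow> nat \<times> real" where
  "DgCo p = (degree p, lead_coeff p)"

end

theory Submission
  imports Defs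
begin

text \<open>
  Expanding \<open>S\<^sub>n - L\<^sub>n\<close> in the Laguerre basis shows that it is minus a combination of the derivatives
  \<open>\<partial>\<^sub>y\<^sup>k K\<^sub>n\<^sub>-\<^sub>1(x, c\<^sub>j)\<close> of the reproducing kernel, with coefficients \<open>\<lambda>\<^sub>j\<^sub>k S\<^sub>n\<^sup>(\<^sup>k\<^sup>)(c\<^sub>j)\<close>. Differentiating
  the Christoffel--Darboux formula \<open>k\<close> times in \<open>y\<close> gives \<open>(x - y) ^ (k + 1) \<partial>\<^sub>y\<^sup>k K\<^sub>n\<^sub>-\<^sub>1(x, y)\<close> in terms of
  Taylor polynomials, and multiplication by \<open>\<rho>\<close> clears the denominators. The identity for the
  derivative then follows from the structure relation \<open>x L\<^sub>n' = n L\<^sub>n + \<gamma>\<^sub>n L\<^sub>n\<^sub>-\<^sub>1\<close> and its companion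
  \<open>x L\<^sub>n\<^sub>-\<^sub>1' = (x - n - \<alpha>) L\<^sub>n\<^sub>-\<^sub>1 - L\<^sub>n\<close>. Finally \<open>h\<^sub>n\<^sub>-\<^sub>1 \<sigma>\<^sub>n\<close> is the squared Laguerre norm of \<open>S\<^sub>n - L\<^sub>n\<close> plus
  the discrete part of \<open>\<langle>S\<^sub>n, S\<^sub>n\<rangle>\<close>; both vanish only if \<open>S\<^sub>n = L\<^sub>n\<close> and \<open>L\<^sub>n\<^sup>(\<^sup>k\<^sup>)(c\<^sub>j) = 0\<close> at every mass,
  and the latter fails for \<open>k \<le> n\<close> since the coefficients of \<open>L\<^sub>n\<close> alternate in sign and \<open>c\<^sub>j < 0\<close>.
\<close>

section \<open>Inner products on polynomials\<close>

lemma poly_monom_induct [case_names monom add]: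
  fixes p :: "'a::comm_monoid_add poly"
  assumes "\<And>a i. P (monom a i)" "\<And>p q. P p \<Longrightarrow> P q \<Longrightarrow> P (p + q)"
  shows "P p"
proof -
  have "P (\<Sum>i\<in>A. monom (coeff p i) i)" if "finite A" for A
    using that
  proof (induction A)
    case empty
    then show ?case using assms(1)[of 0 0] by simp
  qed (simp add: assms)
  then show ?thesis
    by (metis finite_atMost poly_as_sum_of_monoms)
qed

text \<open>Positivity is split off into a second locale, because for the Laguerre form it is
  derived from the expansion in \<open>lag\<close>, which already uses bilinearity.\<close>

locale poly_bilinear_form =
  fixes ip :: "real poly \<Rightarrow> real poly \<Rightarrow> real"
  assumes add_left: "ip (f + g) q = ip f q + ip g q"
    and smult_left: "ip (smult a f) q = a * ip f q"
    and commute: "ip f g = ip g f"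
begin

lemma smult_right: "ip f (smult a g) = a * ip f g"
  by (metis smult_left commute)

lemma diff_left: "ip (f - g) q = ip f q - ip g q"
  using add_left[of "f - g" g q] by simp

lemma diff_right: "ip f (g - q) = ip f g - ip f q"
  by (metis diff_left commute)

lemma zero_left: "ip 0 q = 0"
  using smult_left[of 0 0 q] by simp

lemma sum_left: "ip (sum f A) q = (\<Sum>i\<in>A. ip (f i) q)"
  by (induction A rule: infinite_finite_induct) (simp_all add: zero_left add_left)

lemma sum_right: "ip q (sum f A) = (\<Sum>i\<in>A. ip q (f i))"
  by (simp add: commute[of q] sum_left)

text \<open>Vanishing of all coefficients from \<open>n\<close> on replaces
  \<open>degree p < n\<close>, so that \<open>n = 0\<close> is covered as well, where it means
  \<open>p = 0\<close>.\<close>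

lemma orthogonal_lower:
  assumes "\<forall>k<n. ip f (monom 1 k) = 0" "\<forall>i\<ge>n. coeff p i = 0"
  shows "ip f p = 0"
proof -
  have "ip f p = (\<Sum>i\<le>degree p. ip f (smult (coeff p i) (monom 1 i)))"
    by (subst poly_as_sum_of_monoms[of p, symmetric]) (simp add: sum_right smult_monom)
  also have "\<dots> = 0"
    by (rule sum.neutral) (metis assms not_less smult_right mult_zero_left mult_zero_right)
  finally show ?thesis .
qed

end

locale poly_inner_product = poly_bilinear_form +
  assumes pos: "f \<noteq> 0 \<Longrightarrow> ip f f > 0"
begin

lemma lower_orthogonal_eq_0:
  assumes "\<forall>k<n. ip f (monom 1 k) = 0" "\<forall>i\<ge>n. coeff f i = 0"
  shows "f = 0"
  using orthogonal_lower[OF assms] pos[of f] by force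

lemma monic_orthogonal_unique:
  assumes "degree p = n" "lead_coeff p = 1" "\<forall>k<n. ip p (monom 1 k) = 0"
    and "degree q = n" "lead_coeff q = 1" "\<forall>k<n. ip q (monom 1 k) = 0"
  shows "p = q"
proof -
  have "coeff (p - q) i = 0" if "i \<ge> n" for i
    using that assms by (cases "i = n") (auto simp: coeff_eq_0)
  then have "p - q = 0"
    using assms by (intro lower_orthogonal_eq_0[of n]) (simp_all add: diff_left)
  then show ?thesis by simp
qed

text \<open>Gram-Schmidt: \<open>r\<close> is the orthogonal projection of \<open>f\<close> onto the
  polynomials of degree below \<open>n\<close>.\<close>

lemma lower_projection:
  "\<exists>r. (\<forall>i\<ge>n. coeff r i = 0) \<and> (\<forall>k<n. ip (f - r) (monom 1 k) = 0)"
proof (induction n arbitrary: f)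
  case 0
  then show ?case by (intro exI[of _ 0]) simp
next
  case (Suc n)
  obtain r where r: "\<forall>i\<ge>n. coeff r i = 0" "\<forall>k<n. ip (f - r) (monom 1 k) = 0"
    using Suc by blast
  obtain s where s: "\<forall>i\<ge>n. coeff s i = 0" "\<forall>k<n. ip (monom 1 n - s) (monom 1 k) = 0"
    using Suc by blast
  \<comment> \<open>The new orthogonal direction; since \<open>g\<close> is orthogonal to
    \<open>s\<close>, its pairing with \<open>monom 1 n\<close> is its squared norm, so the division
    in \<open>t\<close> is legitimate.\<close>
  define g where "g = monom 1 n - s"
  have "coeff g n = 1"
    using s(1) by (simp add: g_def)
  then have "ip g g > 0"
    by (intro pos) auto
  moreover have "ip g s = 0"
    using s by (intro orthogonal_lower) (auto simp: g_def)
  ultimately have "ip g (monom 1 n) > 0"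
    by (simp add: g_def diff_right)
  define t where "t = ip (f - r) (monom 1 n) / ip g (monom 1 n)"
  have "ip (f - (r + smult t g)) (monom 1 k) = 0" if "k < Suc n" for k
    using that r(2) s(2) \<open>ip g (monom 1 n) > 0\<close>
    by (cases "k = n") (auto simp: t_def diff_left add_left smult_left g_def[symmetric])
  moreover have "\<forall>i\<ge>Suc n. coeff (r + smult t g) i = 0"
    using r(1) s(1) by (simp add: g_def)
  ultimately show ?case by blast
qed

text \<open>The definite description is proper: \<open>monom 1 n\<close> minus its projection is a
  witness, and positivity makes it unique.\<close>

lemma monic_op_properties:
  shows degree_monic_op: "degree (monic_op ip n) = n"
    and lead_coeff_monic_op: "lead_coeff (monic_op ip n) = 1"
    and monic_op_orthogonal: "\<forall>k<n. ip (monic_op ip n) (monom 1 k) = 0"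
proof -
  let ?P = "\<lambda>p. degree p = n \<and> lead_coeff p = 1 \<and> (\<forall>k<n. ip p (monom 1 k) = 0)"
  obtain r where r: "\<forall>i\<ge>n. coeff r i = 0" "\<forall>k<n. ip (monom 1 n - r) (monom 1 k) = 0"
    using lower_projection by blast
  have c: "coeff (monom 1 n - r) n = 1"
    using r(1) by simp
  moreover have "degree (monom 1 n - r) = n"
  proof (rule antisym)
    show "degree (monom 1 n - r) \<le> n"
      using r(1) by (intro degree_le) auto
    show "degree (monom 1 n - r) \<ge> n"
      using c by (intro le_degree) auto
  qed
  ultimately have "?P (monom 1 n - r)"
    using r(2) by metis
  then have "?P (monic_op ip n)"
    unfolding monic_op_def
  proof (rule theI)
    fix q assume "?P q"
    then show "q = monom 1 n - r"
      using \<open>?P (monom 1 n - r)\<close> by (intro monic_orthogonal_unique[of q n]) auto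
  qed
  then show "degree (monic_op ip n) = n" "lead_coeff (monic_op ip n) = 1"
    "\<forall>k<n. ip (monic_op ip n) (monom 1 k) = 0" by auto
qed

lemma monic_op_eqI:
  assumes "degree p = n" "lead_coeff p = 1" "\<forall>k<n. ip p (monom 1 k) = 0"
  shows "monic_op ip n = p"
  using monic_orthogonal_unique[OF _ _ _ assms] monic_op_properties by metis

end

section \<open>Moments of the Laguerre weight\<close>

lemma has_bochner_integral_Gamma:
  fixes s :: real
  assumes "s > -1"
  shows "has_bochner_integral lborel (\<lambda>x. indicator {0<..} x *\<^sub>R (x powr s * exp (- x))) (Gamma (s + 1))"
proof (rule has_bochner_integral_nn_integral)
  have "(\<integral>\<^sup>+ x. ennreal (indicator {0<..} x *\<^sub>R (x powr s * exp (- x))) \<partial>lborel)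
      = (\<integral>\<^sup>+ x. ennreal (indicator {0..} x * x powr (s + 1 - 1) / exp x) \<partial>lborel)"
    \<comment> \<open>The open and the closed half-line differ only at 0, where
      \<open>0 powr s\<close> is 0.\<close>
    by (intro nn_integral_cong) (auto simp: indicator_def exp_minus field_simps)
  also have "\<dots> = ennreal (Gamma (s + 1))"
    using assms by (subst Gamma_conv_nn_integral_real) auto
  finally show "(\<integral>\<^sup>+ x. ennreal (indicator {0<..} x *\<^sub>R (x powr s * exp (- x))) \<partial>lborel)
      = ennreal (Gamma (s + 1))" .
  show "0 \<le> Gamma (s + 1)"
    using assms by (intro less_imp_le Gamma_real_pos) auto
qed auto

text \<open>The integral of \<open>p\<close> against the weight, written through the moments of
  \<open>x ^ i\<close>; it turns the analysis into finite sums.\<close>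

definition laguerre_moment :: "real \<Rightarrow> real poly \<Rightarrow> real" where
  "laguerre_moment \<alpha> p = (\<Sum>i\<le>degree p. coeff p i * Gamma (real i + \<alpha> + 1))"

lemma laguerre_moment_altdef:
  assumes "degree p \<le> n"
  shows "laguerre_moment \<alpha> p = (\<Sum>i\<le>n. coeff p i * Gamma (real i + \<alpha> + 1))"
  unfolding laguerre_moment_def
  using assms by (intro sum.mono_neutral_left) (auto simp: coeff_eq_0)

lemma laguerre_moment_add: "laguerre_moment \<alpha> (p + q) = laguerre_moment \<alpha> p + laguerre_moment \<alpha> q"
proof -
  define n where "n = max (degree p) (degree q)"
  have "degree p \<le> n" "degree q \<le> n" "degree (p + q) \<le> n"
    by (auto simp: n_def degree_add_le_max)
  then show ?thesis
    by (simp add: laguerre_moment_altdef[of _ n] sum.distrib algebra_simps)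
qed

lemma laguerre_moment_smult: "laguerre_moment \<alpha> (smult a p) = a * laguerre_moment \<alpha> p"
  by (simp add: laguerre_moment_altdef[of "smult a p" "degree p"] laguerre_moment_def
      sum_distrib_left mult.assoc)

lemma laguerre_moment_diff: "laguerre_moment \<alpha> (p - q) = laguerre_moment \<alpha> p - laguerre_moment \<alpha> q"
  using laguerre_moment_add[of \<alpha> "p - q" q] by simp

lemma laguerre_moment_monom: "laguerre_moment \<alpha> (monom a i) = a * Gamma (real i + \<alpha> + 1)"
  by (subst laguerre_moment_altdef[of _ i]) (auto simp: degree_monom_le if_distrib[of "\<lambda>x. x * _"] cong: if_cong)

text \<open>The induction carries \<open>has_bochner_integral\<close>, so integrability comes along
  with the value and additivity is available.\<close>

lemma laguerre_ip_eq_moment: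
  assumes "\<alpha> > -1"
  shows "laguerre_ip \<alpha> f g = laguerre_moment \<alpha> (f * g)"
proof -
  have "has_bochner_integral lborel
      (\<lambda>x. indicator {0<..} x *\<^sub>R (poly p x * (x powr \<alpha> * exp (- x)))) (laguerre_moment \<alpha> p)" for p
  proof (induction p rule: poly_monom_induct)
    case (monom a i)
    have "has_bochner_integral lborel
        (\<lambda>x. a * (indicator {0<..} x *\<^sub>R (x powr (real i + \<alpha>) * exp (- x))))
        (a * Gamma (real i + \<alpha> + 1))"
      using assms by (intro has_bochner_integral_mult_right has_bochner_integral_Gamma) auto
    then show ?case
      by (rule has_bochner_integral_cong[THEN iffD1, rotated 3])
        (auto simp: laguerre_moment_monom poly_monom indicator_def powr_add powr_realpow)
  next
    case (add p q)
    then show ?case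
      by (auto dest: has_bochner_integral_add simp: laguerre_moment_add algebra_simps)
  qed
  from has_bochner_integral_integral_eq[OF this, of "f * g"] show ?thesis
    by (simp add: laguerre_ip_def set_lebesgue_integral_def)
qed

text \<open>Integration by parts against the weight \<open>w\<close>, which satisfies the Pearson equation
  \<open>(x w)' = (\<alpha> + 1 - x) w\<close>.\<close>

lemma laguerre_moment_pderiv:
  assumes "\<alpha> > -1"
  shows "laguerre_moment \<alpha> ([:0, 1:] * pderiv p) = laguerre_moment \<alpha> ([:- \<alpha> - 1, 1:] * p)"
proof (induction p rule: poly_monom_induct)
  case (monom a i)
  have A: "[:0, 1:] * pderiv (monom a i) = smult (real i) (monom a i)"
    by (rule poly_eqI) (auto simp: coeff_pderiv coeff_pCons split: nat.split)
  have B: "[:- \<alpha> - 1, 1:] * monom a i = monom a (Suc i) - smult (\<alpha> + 1) (monom a i)"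
    by (rule poly_eqI) (auto simp: coeff_pCons algebra_simps split: nat.split)
  have "real (Suc i) + \<alpha> + 1 = (real i + \<alpha> + 1) + 1"
    by simp
  then have "Gamma (real (Suc i) + \<alpha> + 1) = (real i + \<alpha> + 1) * Gamma (real i + \<alpha> + 1)"
    using Gamma_plus1[of "real i + \<alpha> + 1"] assms by (force dest: nonpos_Ints_nonpos)
  then show ?case
    unfolding A B laguerre_moment_diff laguerre_moment_smult laguerre_moment_monom
    by (simp only:) (simp add: algebra_simps)
next
  case (add p q)
  then show ?case
    by (simp add: laguerre_moment_add pderiv_add distrib_left del: mult_pCons_left)
qed

section \<open>Laguerre polynomials\<close>

text \<open>Rodrigues' formula in recursive form. Passing from \<open>n\<close> to \<open>n + 1\<close> multiplies the pairing with
  \<open>x ^ k\<close> by \<open>k - n\<close>, so orthogonality and norms come out together.\<close>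

primrec lag :: "real \<Rightarrow> nat \<Rightarrow> real poly" where
  "lag \<alpha> 0 = 1"
| "lag \<alpha> (Suc n) = [:- (real n + 1 + \<alpha>), 1:] * lag \<alpha> n - [:0, 1:] * pderiv (lag \<alpha> n)"

lemma coeff_lag_Suc:
  "coeff (lag \<alpha> (Suc n)) j =
     (if j = 0 then 0 else coeff (lag \<alpha> n) (j - 1)) - (real n + 1 + \<alpha> + real j) * coeff (lag \<alpha> n) j"
  by (auto simp: coeff_pCons coeff_pderiv algebra_simps split: nat.split)

lemma coeff_lag_eq_0: "j > n \<Longrightarrow> coeff (lag \<alpha> n) j = 0"
  by (induction n arbitrary: j) (auto simp: coeff_lag_Suc simp del: lag.simps(2))

lemma coeff_lag_self: "coeff (lag \<alpha> n) n = 1"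
  by (induction n) (auto simp: coeff_lag_Suc coeff_lag_eq_0 simp del: lag.simps(2))

lemma degree_lag: "degree (lag \<alpha> n) = n"
  by (rule antisym) (auto simp: coeff_lag_self coeff_lag_eq_0 intro!: degree_le le_degree)

text \<open>In \<open>coeff_lag_Suc\<close> the factor \<open>real n + 1 + \<alpha> + real j\<close>
  is positive, so after multiplication by the sign both terms are nonnegative, and the second one is
  positive for \<open>j \<le> n\<close>.\<close>

lemma coeff_lag_alternating:
  assumes "\<alpha> > -1" "j \<le> n"
  shows "(-1) ^ (n + j) * coeff (lag \<alpha> n) j > 0"
  using assms(2)
proof (induction n arbitrary: j)
  case 0
  then show ?case by simp
next
  case (Suc n)
  show ?case
  proof (cases "j \<le> n")
    case True
    have eq: "(-1) ^ (Suc n + j) * coeff (lag \<alpha> (Suc n)) j =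
        (if j = 0 then 0 else (-1) ^ (n + (j - 1)) * coeff (lag \<alpha> n) (j - 1))
        + (real n + 1 + \<alpha> + real j) * ((-1) ^ (n + j) * coeff (lag \<alpha> n) j)"
      by (cases j) (simp_all add: coeff_lag_Suc algebra_simps del: lag.simps(2))
    show ?thesis
      unfolding eq using Suc.IH[of j] Suc.IH[of "j - 1"] True assms(1)
      by (intro add_nonneg_pos[OF _ mult_pos_pos]) (auto simp: less_imp_le)
  next
    case False
    then have "j = Suc n" using Suc.prems by simp
    then show ?thesis using coeff_lag_self[of \<alpha> "Suc n"] by (simp flip: power_add mult_2 del: lag.simps(2))
  qed
qed

text \<open>Integration by parts applied to \<open>p * monom 1 k\<close>: the product rule leaves an
  extra multiple \<open>real k\<close> of this product, which shifts \<alpha> to \<alpha> +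
  k.\<close>

lemma laguerre_moment_pderiv_monom:
  assumes "\<alpha> > -1"
  shows "laguerre_moment \<alpha> ([:0, 1:] * pderiv p * monom 1 k) =
    laguerre_moment \<alpha> ([:- (\<alpha> + 1 + real k), 1:] * p * monom 1 k)"
proof -
  have X: "[:0, 1:] * pderiv (monom 1 k) = smult (real k) (monom (1::real) k)"
    by (rule poly_eqI) (auto simp: coeff_pderiv coeff_pCons split: nat.split)
  have "[:0, 1:] * pderiv (p * monom 1 k)
      = p * ([:0, 1:] * pderiv (monom 1 k)) + [:0, 1:] * pderiv p * monom 1 k"
    unfolding pderiv_mult by (simp only: algebra_simps)
  then have "[:0, 1:] * pderiv p * monom 1 k
      = [:0, 1:] * pderiv (p * monom 1 k) - smult (real k) (p * monom 1 k)"
    unfolding X by simp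
  then have "laguerre_moment \<alpha> ([:0, 1:] * pderiv p * monom 1 k)
      = laguerre_moment \<alpha> ([:- \<alpha> - 1, 1:] * (p * monom 1 k) - smult (real k) (p * monom 1 k))"
    by (simp only: laguerre_moment_diff laguerre_moment_pderiv[OF assms])
  also have "[:- \<alpha> - 1, 1:] * (p * monom 1 k) - smult (real k) (p * monom 1 k)
      = ([:- \<alpha> - 1, 1:] - [:real k:]) * (p * monom 1 k)"
    by (simp only: left_diff_distrib) simp
  also have "[:- \<alpha> - 1, 1:] - [:real k:] = [:- (\<alpha> + 1 + real k), 1:]"
    by simp
  finally show ?thesis by (simp only: mult.assoc)
qed

text \<open>The linear factors of the recursion and of integration by parts differ by the constant
  \<open>real k - real n\<close>. The product is 0 for \<open>k < n\<close> and
  \<open>fact n\<close> for \<open>k = n\<close>.\<close>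

lemma laguerre_moment_lag:
  assumes "\<alpha> > -1"
  shows "laguerre_moment \<alpha> (lag \<alpha> n * monom 1 k) = (\<Prod>i<n. real k - real i) * Gamma (real k + \<alpha> + 1)"
proof (induction n)
  case 0
  then show ?case by (simp add: laguerre_moment_monom)
next
  case (Suc n)
  have "laguerre_moment \<alpha> (lag \<alpha> (Suc n) * monom 1 k)
      = laguerre_moment \<alpha> ([:- (real n + 1 + \<alpha>), 1:] * lag \<alpha> n * monom 1 k)
        - laguerre_moment \<alpha> ([:- (\<alpha> + 1 + real k), 1:] * lag \<alpha> n * monom 1 k)"
    unfolding lag.simps left_diff_distrib laguerre_moment_diff
    by (simp only: laguerre_moment_pderiv_monom[OF assms])
  also have "\<dots> = laguerre_moment \<alpha>
      (([:- (real n + 1 + \<alpha>), 1:] - [:- (\<alpha> + 1 + real k), 1:]) * (lag \<alpha> n * monom 1 k))"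
    by (simp only: left_diff_distrib laguerre_moment_diff mult.assoc)
  also have "[:- (real n + 1 + \<alpha>), 1:] - [:- (\<alpha> + 1 + real k), 1:] = [:real k - real n:]"
    by simp
  finally show ?case
    using Suc by (simp add: laguerre_moment_smult)
qed

lemma laguerre_moment_lag_lower:
  assumes "\<alpha> > -1" "k < n"
  shows "laguerre_moment \<alpha> (lag \<alpha> n * monom 1 k) = 0"
  using assms by (auto simp: laguerre_moment_lag)

lemma laguerre_moment_lag_self:
  assumes "\<alpha> > -1"
  shows "laguerre_moment \<alpha> (lag \<alpha> n * monom 1 n) = h \<alpha> n"
proof -
  have "(\<Prod>i<n. real n - real i) = fact n"
    by (simp add: fact_prod_rev lessThan_atLeast0 of_nat_diff)
  then show ?thesis
    by (simp add: laguerre_moment_lag[OF assms] h_def)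
qed

lemma h_pos:
  assumes "\<alpha> > -1"
  shows "h \<alpha> n > 0"
  using assms by (auto simp: h_def intro!: Gamma_real_pos)

lemma h_Suc:
  assumes "\<alpha> > -1"
  shows "h \<alpha> (Suc n) = gam \<alpha> (Suc n) * h \<alpha> n"
proof -
  have "Gamma (real n + \<alpha> + 1 + 1) = (real n + \<alpha> + 1) * Gamma (real n + \<alpha> + 1)"
    using Gamma_plus1[of "real n + \<alpha> + 1"] assms by (force dest: nonpos_Ints_nonpos)
  then show ?thesis
    by (simp add: h_def gam_def algebra_simps)
qed

lemma laguerre_bilinear:
  assumes "\<alpha> > -1"
  shows "poly_bilinear_form (laguerre_ip \<alpha>)"
  by unfold_locales
    (simp_all add: laguerre_ip_eq_moment[OF assms] laguerre_moment_add laguerre_moment_smult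
      algebra_simps)

locale laguerre_weight =
  fixes \<alpha> :: real
  assumes alpha: "\<alpha> > -1"
begin

sublocale poly_bilinear_form "laguerre_ip \<alpha>"
  using alpha by (rule laguerre_bilinear)

lemma ip_lag_lower:
  assumes "\<forall>i\<ge>n. coeff p i = 0"
  shows "laguerre_ip \<alpha> (lag \<alpha> n) p = 0"
  using assms
  by (intro orthogonal_lower[of n])
    (auto simp: laguerre_ip_eq_moment alpha laguerre_moment_lag_lower)

lemma ip_lag_self: "laguerre_ip \<alpha> (lag \<alpha> n) (lag \<alpha> n) = h \<alpha> n"
proof -
  have "coeff (lag \<alpha> n - monom 1 n) i = 0" if "i \<ge> n" for i
    using that by (cases "i = n") (auto simp: coeff_lag_self coeff_lag_eq_0)
  then have "laguerre_ip \<alpha> (lag \<alpha> n) (lag \<alpha> n - monom 1 n) = 0"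
    by (intro ip_lag_lower) auto
  moreover have "laguerre_ip \<alpha> (lag \<alpha> n) (monom 1 n) = h \<alpha> n"
    by (simp add: laguerre_ip_eq_moment alpha laguerre_moment_lag_self)
  ultimately show ?thesis
    by (simp add: diff_right)
qed

text \<open>Subtracting the leading term leaves \<open>r\<close>, orthogonal to
  \<open>lag \<alpha> n\<close>; hence the leading coefficient is the Fourier coefficient. This
  rests on orthogonality and \<open>h \<alpha> n > 0\<close>, so positivity of the form can be
  derived from it.\<close>

lemma lag_expansion:
  assumes "\<forall>i\<ge>n. coeff p i = 0"
  shows "p = (\<Sum>i<n. smult (laguerre_ip \<alpha> p (lag \<alpha> i) / h \<alpha> i) (lag \<alpha> i))"
  using assms
proof (induction n arbitrary: p)
  case 0
  then show ?case by (simp add: poly_eq_iff)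
next
  case (Suc n)
  define a where "a = coeff p n"
  define r where "r = p - smult a (lag \<alpha> n)"
  have r: "\<forall>i\<ge>n. coeff r i = 0"
  proof (intro allI impI)
    fix i assume "i \<ge> n"
    then show "coeff r i = 0"
      using Suc.prems by (cases "i = n") (simp_all add: r_def a_def coeff_lag_self coeff_lag_eq_0)
  qed
  have "laguerre_ip \<alpha> p (lag \<alpha> n) = a * h \<alpha> n"
    using ip_lag_lower[OF r]
    by (simp add: r_def diff_right smult_right ip_lag_self commute[of p])
  then have a: "laguerre_ip \<alpha> p (lag \<alpha> n) / h \<alpha> n = a"
    using h_pos[OF alpha, of n] by simp
  have "laguerre_ip \<alpha> r (lag \<alpha> i) = laguerre_ip \<alpha> p (lag \<alpha> i)" if "i < n" for i
    using that ip_lag_lower[of n "lag \<alpha> i"]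
    by (simp add: r_def diff_left smult_left coeff_lag_eq_0)
  then have "r = (\<Sum>i<n. smult (laguerre_ip \<alpha> p (lag \<alpha> i) / h \<alpha> i) (lag \<alpha> i))"
    using Suc.IH[OF r] by simp
  then show ?case
    using a by (simp add: r_def algebra_simps)
qed

text \<open>Parseval: in the basis \<open>lag\<close> the form becomes a sum of squares divided by
  the positive numbers \<open>h \<alpha> i\<close>.\<close>

lemma laguerre_ip_pos:
  assumes "p \<noteq> 0"
  shows "laguerre_ip \<alpha> p p > 0"
proof -
  define n where "n = Suc (degree p)"
  define a where "a i = laguerre_ip \<alpha> p (lag \<alpha> i)" for i
  have exp: "p = (\<Sum>i<n. smult (a i / h \<alpha> i) (lag \<alpha> i))"
    unfolding a_def by (rule lag_expansion) (auto simp: n_def coeff_eq_0)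
  have "laguerre_ip \<alpha> p p = laguerre_ip \<alpha> p (\<Sum>i<n. smult (a i / h \<alpha> i) (lag \<alpha> i))"
    using exp by simp
  also have "\<dots> = (\<Sum>i<n. (a i)\<^sup>2 / h \<alpha> i)"
    by (simp add: sum_right smult_right a_def power2_eq_square)
  finally have eq: "laguerre_ip \<alpha> p p = (\<Sum>i<n. (a i)\<^sup>2 / h \<alpha> i)" .
  have "\<exists>i<n. a i \<noteq> 0"
    using assms exp by (metis (no_types, lifting) div_0 lessThan_iff smult_0_left sum.neutral)
  then obtain i where "i < n" "a i \<noteq> 0" by blast
  then show ?thesis
    unfolding eq using h_pos[OF alpha]
    by (intro sum_pos2[of _ i]) (auto simp: less_imp_le)
qed

sublocale poly_inner_product "laguerre_ip \<alpha>"
  by unfold_locales (rule laguerre_ip_pos)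

lemma laguerre_eq_lag: "laguerre \<alpha> n = lag \<alpha> n"
  unfolding laguerre_def
  by (rule monic_op_eqI)
    (auto simp: degree_lag coeff_lag_self ip_lag_lower)

section \<open>Structure relations and three-term recurrence\<close>

text \<open>The difference \<open>f\<close> of the two sides has degree below \<open>n\<close>,
  because the leading terms cancel, and it is orthogonal to all \<open>x ^ k\<close> with
  \<open>k < n\<close>; hence it is 0.\<close>

lemma lag_structure:
  assumes "n \<ge> 1"
  shows "[:0, 1:] * pderiv (lag \<alpha> n) = smult (real n) (lag \<alpha> n) + smult (gam \<alpha> n) (lag \<alpha> (n - 1))"
proof -
  obtain m where n: "n = Suc m"
    using assms by (cases n) auto
  define f where
    "f = [:0, 1:] * pderiv (lag \<alpha> n) - smult (real n) (lag \<alpha> n) - smult (gam \<alpha> n) (lag \<alpha> m)"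
  have "coeff ([:0, 1:] * pderiv (lag \<alpha> n)) i = real i * coeff (lag \<alpha> n) i" for i
    by (cases i) (simp_all add: coeff_pderiv)
  then have lower: "\<forall>i\<ge>n. coeff f i = 0"
    by (auto simp: f_def le_less coeff_lag_eq_0 n simp del: mult_pCons_left lag.simps)
  have "laguerre_ip \<alpha> f (monom 1 k) = 0" if "k < n" for k
  proof -
    have "laguerre_ip \<alpha> ([:0, 1:] * pderiv (lag \<alpha> n)) (monom 1 k)
        = laguerre_moment \<alpha> ([:- (\<alpha> + 1 + real k), 1:] * lag \<alpha> n * monom 1 k)"
      by (simp only: laguerre_ip_eq_moment alpha laguerre_moment_pderiv_monom)
    also have "[:- (\<alpha> + 1 + real k), 1:] * lag \<alpha> n * monom 1 k
        = lag \<alpha> n * monom 1 (Suc k) - smult (\<alpha> + 1 + real k) (lag \<alpha> n * monom 1 k)"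
      by (simp add: monom_Suc distrib_right left_diff_distrib smult_diff_left smult_add_left)
    finally have 1: "laguerre_ip \<alpha> ([:0, 1:] * pderiv (lag \<alpha> n)) (monom 1 k)
        = laguerre_moment \<alpha> (lag \<alpha> n * monom 1 (Suc k))"
      using that
      by (simp only: laguerre_moment_diff laguerre_moment_smult laguerre_moment_lag_lower alpha)
    have 2: "laguerre_ip \<alpha> (lag \<alpha> n) (monom 1 k) = 0"
      using that by (simp add: ip_lag_lower)
    show ?thesis
    \<comment> \<open>Only \<open>k = m\<close> gives nonzero pairings: \<open>h \<alpha> n\<close>
      and \<open>gam \<alpha> n * h \<alpha> m\<close>, which cancel by
      \<open>h_Suc\<close>.\<close>
    proof (cases "k = m")
      case True
      then show ?thesis
        using h_Suc[OF alpha, of m] 1 2 laguerre_moment_lag_self[OF alpha]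
        by (simp add: f_def diff_left smult_left n laguerre_ip_eq_moment alpha del: mult_pCons_left lag.simps)
    next
      case False
      then have "k < m" using that n by simp
      then show ?thesis
        using 1 2 laguerre_moment_lag_lower[OF alpha, of "Suc k" n] ip_lag_lower[of m "monom 1 k"] n
        by (simp add: f_def diff_left smult_left del: mult_pCons_left lag.simps)
    qed
  qed
  then have "f = 0"
    using lower by (intro lower_orthogonal_eq_0) auto
  then show ?thesis
    by (simp add: f_def n algebra_simps del: mult_pCons_left lag.simps)
qed

text \<open>The recursion defining \<open>lag\<close>, solved for the derivative.\<close>

lemma lag_structure_pred:
  assumes "n \<ge> 1"
  shows "[:0, 1:] * pderiv (lag \<alpha> (n - 1)) = [:- (real n + \<alpha>), 1:] * lag \<alpha> (n - 1) - lag \<alpha> n"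
  using assms by (cases n) (simp_all add: algebra_simps)

lemma lag_recurrence:
  "lag \<alpha> (Suc (Suc n)) =
     [:- (2 * real n + 3 + \<alpha>), 1:] * lag \<alpha> (Suc n) - smult (gam \<alpha> (Suc n)) (lag \<alpha> n)"
proof -
  have "lag \<alpha> (Suc (Suc n)) = [:- (real (Suc n) + 1 + \<alpha>), 1:] * lag \<alpha> (Suc n)
      - (smult (real (Suc n)) (lag \<alpha> (Suc n)) + smult (gam \<alpha> (Suc n)) (lag \<alpha> n))"
    using lag_structure[of "Suc n"] by (simp only: lag.simps(2)[of _ "Suc n"]) simp
  also have "\<dots> = ([:- (real (Suc n) + 1 + \<alpha>), 1:] - [:real (Suc n):]) * lag \<alpha> (Suc n)
      - smult (gam \<alpha> (Suc n)) (lag \<alpha> n)"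
    by (simp only: left_diff_distrib) simp
  also have "[:- (real (Suc n) + 1 + \<alpha>), 1:] - [:real (Suc n):] = [:- (2 * real n + 3 + \<alpha>), 1:]"
    by simp
  finally show ?thesis .
qed

section \<open>Reproducing kernel and Christoffel-Darboux formula\<close>

text \<open>The reproducing kernel of the polynomials of degree below \<open>n\<close>, with
  \<open>x\<close> a fixed real and \<open>y\<close> the polynomial variable, so that
  \<open>pderiv\<close> differentiates in \<open>y\<close>; likewise \<open>[:x, -1:]\<close> below
  is x - y.\<close>

definition kernel :: "nat \<Rightarrow> real \<Rightarrow> real poly" where
  "kernel n x = (\<Sum>i<n. smult (poly (lag \<alpha> i) x / h \<alpha> i) (lag \<alpha> i))"

lemma christoffel_darboux:
  assumes "n \<ge> 1"
  shows "[:x, -1:] * kernel n x =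
    smult (poly (lag \<alpha> n) x / h \<alpha> (n - 1)) (lag \<alpha> (n - 1))
    - smult (poly (lag \<alpha> (n - 1)) x / h \<alpha> (n - 1)) (lag \<alpha> n)"
proof -
  have "(x - y) * poly (kernel (Suc m) x) y =
      (poly (lag \<alpha> (Suc m)) x * poly (lag \<alpha> m) y - poly (lag \<alpha> m) x * poly (lag \<alpha> (Suc m)) y) / h \<alpha> m"
    for m y
  proof (induction m)
    case 0
    then show ?case by (simp add: kernel_def field_simps)
  next
    case (Suc m)
    define a b a' b' where
      "a = poly (lag \<alpha> m) x" "b = poly (lag \<alpha> m) y"
      "a' = poly (lag \<alpha> (Suc m)) x" "b' = poly (lag \<alpha> (Suc m)) y"
    define g t where "g = gam \<alpha> (Suc m)" "t = 2 * real m + 3 + \<alpha>"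
    have "g > 0" "h \<alpha> m > 0"
      using alpha h_pos[OF alpha] by (auto simp: g_t_def gam_def)
    moreover have "h \<alpha> (Suc m) = g * h \<alpha> m"
      by (simp add: g_t_def h_Suc alpha)
    moreover have "poly (lag \<alpha> (Suc (Suc m))) x = (x - t) * a' - g * a"
      "poly (lag \<alpha> (Suc (Suc m))) y = (y - t) * b' - g * b"
      unfolding lag_recurrence by (simp_all add: g_t_def a_b_a'_b'_def algebra_simps del: lag.simps)
    moreover have "(x - y) * poly (kernel (Suc (Suc m)) x) y
        = (a' * b - a * b') / h \<alpha> m + (x - y) * (a' * b' / h \<alpha> (Suc m))"
      using Suc by (simp add: kernel_def a_b_a'_b'_def distrib_left del: lag.simps)
    \<comment> \<open>By the recurrence the numerator for \<open>Suc m\<close> is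
      \<open>(x - y) * a' * b'\<close> plus \<open>g\<close> times the one for \<open>m\<close>; the
      factor \<open>g\<close> cancels against \<open>h \<alpha> (Suc m)\<close>.\<close>
    ultimately show ?case
      unfolding a_b_a'_b'_def[symmetric] by (simp only:) (simp add: field_simps)
  qed
  then have "poly ([:x, -1:] * kernel n x) y = poly (smult (poly (lag \<alpha> n) x / h \<alpha> (n - 1)) (lag \<alpha> (n - 1))
    - smult (poly (lag \<alpha> (n - 1)) x / h \<alpha> (n - 1)) (lag \<alpha> n)) y" for y
    using assms by (cases n) (auto simp: algebra_simps diff_divide_distrib simp del: lag.simps)
  then show ?thesis
    using poly_eq_poly_eq_iff by blast
qed

text \<open>At \<open>x < 0\<close> the alternation of the coefficients gives every term of the
  derivative the sign \<open>(-1) ^ (n + k)\<close>, so nothing cancels.\<close>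

lemma higher_pderiv_lag_nonzero:
  assumes "x < 0" "k \<le> n"
  shows "poly ((pderiv ^^ k) (lag \<alpha> n)) x \<noteq> 0"
proof -
  let ?c = "\<lambda>i. coeff ((pderiv ^^ k) (lag \<alpha> n)) i"
  have "(-1) ^ (n + k) * poly ((pderiv ^^ k) (lag \<alpha> n)) x = (\<Sum>i\<le>n - k. (-1) ^ (n + k) * (?c i * x ^ i))"
    by (simp add: poly_altdef degree_higher_pderiv degree_lag sum_distrib_left)
  also have "\<dots> > 0"
  proof (rule sum_pos)
    fix i assume i: "i \<in> {..n - k}"
    have "(-1) ^ (n + k) * (?c i * x ^ i)
        = pochhammer (1 + real i) k * ((-1) ^ (n + (i + k)) * coeff (lag \<alpha> n) (i + k)) * (- x) ^ i"
      by (simp add: coeff_higher_pderiv power_minus[of x] power_add)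
    moreover have "(-1) ^ (n + (i + k)) * coeff (lag \<alpha> n) (i + k) > 0"
      using i assms by (intro coeff_lag_alternating alpha) auto
    ultimately show "(-1) ^ (n + k) * (?c i * x ^ i) > 0"
      using assms by (simp add: pochhammer_pos)
  qed auto
  finally show ?thesis by auto
qed

end

section \<open>Derivatives of a quotient by a linear factor, and Taylor polynomials\<close>

text \<open>Leibniz rule with a linear factor of derivative -1; stated for \<open>Suc k\<close> so
  that no \<open>k - 1\<close> occurs.\<close>

lemma higher_pderiv_linear_mult:
  fixes q :: "real poly"
  shows "(pderiv ^^ Suc k) ([:x, -1:] * q) =
    [:x, -1:] * (pderiv ^^ Suc k) q - smult (real (Suc k)) ((pderiv ^^ k) q)"
proof (induction k)
  case 0
  then show ?case by (simp add: pderiv_mult pderiv_pCons pderiv_add pderiv_smult pderiv_minus)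
next
  case (Suc k)
  have "(pderiv ^^ Suc (Suc k)) ([:x, -1:] * q)
      = pderiv ([:x, -1:] * (pderiv ^^ Suc k) q) - smult (real (Suc k)) ((pderiv ^^ Suc k) q)"
    using Suc by (simp add: pderiv_diff pderiv_smult del: mult_pCons_left)
  also have "pderiv ([:x, -1:] * (pderiv ^^ Suc k) q)
      = [:x, -1:] * (pderiv ^^ Suc (Suc k)) q - (pderiv ^^ Suc k) q"
    unfolding pderiv_mult by (simp add: pderiv_pCons)
  finally show ?case
    by (simp only: of_nat_Suc[of "Suc k"] smult_add_left smult_1_left diff_diff_eq)
qed

text \<open>The k-th derivative in \<open>y\<close> of p(y) / (x - y): clearing the denominator
  leaves \<open>fact k\<close> times the Taylor polynomial of \<open>p\<close> at \<open>y\<close>,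
  evaluated at \<open>x\<close>. The induction solves the Leibniz rule for the next derivative of
  \<open>q\<close>.\<close>

lemma higher_pderiv_linear_quotient:
  fixes p q :: "real poly"
  assumes "[:x, -1:] * q = p"
  shows "(x - y) ^ Suc k * poly ((pderiv ^^ k) q) y =
    fact k * (\<Sum>\<nu>\<le>k. poly ((pderiv ^^ \<nu>) p) y / fact \<nu> * (x - y) ^ \<nu>)"
proof (induction k)
  case 0
  then show ?case by (simp add: assms[symmetric] algebra_simps)
next
  case (Suc k)
  have "poly ((pderiv ^^ Suc k) p) y
      = (x - y) * poly ((pderiv ^^ Suc k) q) y - real (Suc k) * poly ((pderiv ^^ k) q) y"
    unfolding assms[symmetric] higher_pderiv_linear_mult by (simp add: algebra_simps)
  then have "(x - y) ^ Suc (Suc k) * poly ((pderiv ^^ Suc k) q) y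
      = (x - y) ^ Suc k * (poly ((pderiv ^^ Suc k) p) y + real (Suc k) * poly ((pderiv ^^ k) q) y)"
    by simp
  also have "\<dots> = (x - y) ^ Suc k * poly ((pderiv ^^ Suc k) p) y
      + real (Suc k) * ((x - y) ^ Suc k * poly ((pderiv ^^ k) q) y)"
    by (simp only: algebra_simps)
  also have "\<dots> = fact (Suc k) * (poly ((pderiv ^^ Suc k) p) y / fact (Suc k) * (x - y) ^ Suc k)
      + real (Suc k) * (fact k * (\<Sum>\<nu>\<le>k. poly ((pderiv ^^ \<nu>) p) y / fact \<nu> * (x - y) ^ \<nu>))"
    unfolding Suc.IH by (simp del: funpow.simps fact_Suc)
  also have "\<dots> = fact (Suc k) * (\<Sum>\<nu>\<le>Suc k. poly ((pderiv ^^ \<nu>) p) y / fact \<nu> * (x - y) ^ \<nu>)"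
    by (simp add: distrib_left add.commute del: funpow.simps)
  finally show ?case .
qed

lemma poly_taylor_poly:
  "poly (taylor_poly k y f) x = (\<Sum>\<nu>\<le>k. poly ((pderiv ^^ \<nu>) f) y / fact \<nu> * (x - y) ^ \<nu>)"
  by (simp add: taylor_poly_def poly_sum)

lemma degree_taylor_poly_le: "degree (taylor_poly k y f) \<le> k"
  unfolding taylor_poly_def
  by (intro degree_sum_le) (auto intro!: order.trans[OF degree_smult_le] simp: degree_linear_power)

lemma coeff_taylor_poly_self: "coeff (taylor_poly k y f) k = poly ((pderiv ^^ k) f) y / fact k"
proof -
  have "coeff ([:-y, 1:] ^ \<nu>) k = (if \<nu> = k then 1 else 0)" if "\<nu> \<le> k" for \<nu>
    using that coeff_eq_0[of "[:-y, 1:] ^ \<nu>" k] lead_coeff_power[of "[:-y, 1:]" k]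
    by (auto simp: degree_linear_power)
  then have "coeff (taylor_poly k y f) k
      = (\<Sum>\<nu>\<le>k. if \<nu> = k then poly ((pderiv ^^ k) f) y / fact k else 0)"
    unfolding taylor_poly_def coeff_sum by (intro sum.cong) auto
  then show ?thesis by simp
qed

section \<open>Discrete Sobolev polynomials\<close>

lemma higher_pderiv_diff:
  fixes p q :: "'a::idom poly"
  shows "(pderiv ^^ n) (p - q) = (pderiv ^^ n) p - (pderiv ^^ n) q"
  using higher_pderiv_add[of n "p - q" q] by (simp add: algebra_simps)

lemma finite_I_plus: "finite (I_plus N d lam)"
proof (rule finite_subset)
  show "I_plus N d lam \<subseteq> Sigma {1..N} (\<lambda>j. {..d j})"
    by (auto simp: I_plus_def)
qed auto

section \<open>The polynomial rho and its quotients: degrees and leading coefficients\<close>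

lemma degree_rho: "degree (rho N c d) = dtot N d"
  unfolding rho_def dtot_def
  by (subst degree_prod_sum_eq) (auto simp: degree_linear_power simp del: power_Suc)

lemma lead_coeff_rho: "lead_coeff (rho N c d) = 1"
  by (simp add: rho_def lead_coeff_prod lead_coeff_power del: power_Suc)

lemma rho_eq_rho_jk_mult:
  assumes "j \<in> {1..N}" "k \<le> d j"
  shows "rho N c d = rho_jk N c d j k * [:- c j, 1:] ^ (k + 1)"
proof -
  have "[:- c j, 1:] ^ (k + 1) dvd [:- c j, 1:] ^ (d j + 1)"
    using assms by (intro le_imp_power_dvd) auto
  also have "\<dots> dvd rho N c d"
    unfolding rho_def using assms by (intro dvd_prodI) auto
  finally show ?thesis
    by (simp add: rho_jk_def del: power_Suc)
qed

lemma degree_rho_jk: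
  assumes "j \<in> {1..N}" "k \<le> d j"
  shows "degree (rho_jk N c d j k) + (k + 1) = dtot N d"
proof -
  have "rho N c d \<noteq> 0"
    using lead_coeff_rho[of N c d] by auto
  then show ?thesis
    using degree_rho[of N c d] unfolding rho_eq_rho_jk_mult[of j N k d c, OF assms]
    by (subst (asm) degree_mult_eq) (auto simp: degree_linear_power simp del: power_Suc)
qed

lemma lead_coeff_rho_jk:
  assumes "j \<in> {1..N}" "k \<le> d j"
  shows "lead_coeff (rho_jk N c d j k) = 1"
  using lead_coeff_rho[of N c d] unfolding rho_eq_rho_jk_mult[of j N k d c, OF assms] lead_coeff_mult
  by (simp add: lead_coeff_power del: power_Suc)

text \<open>The bound is independent of \<open>k\<close>: the Taylor polynomial has degree at most
  \<open>k\<close>, and \<open>rho_jk\<close> has degree \<open>dtot N d - (k + 1)\<close>.\<close>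

lemma degree_taylor_rho_jk_le:
  assumes "j \<in> {1..N}" "k \<le> d j"
  shows "degree (smult a (taylor_poly k y f) * rho_jk N c d j k) \<le> dtot N d - 1"
  using degree_mult_le[of "smult a (taylor_poly k y f)" "rho_jk N c d j k"]
    degree_smult_le[of a "taylor_poly k y f"] degree_taylor_poly_le[of k y f]
    degree_rho_jk[of j N k d c, OF assms]
  by linarith

text \<open>Stated with bounds, since the Taylor polynomial has degree below \<open>k\<close> when
  \<open>k > 0\<close> and the k-th derivative vanishes at the base point.\<close>

lemma coeff_mult_degree_le:
  fixes p q :: "'a::comm_semiring_0 poly"
  assumes "degree p \<le> m" "degree q \<le> n"
  shows "coeff (p * q) (m + n) = coeff p m * coeff q n"
proof (cases "degree p = m \<and> degree q = n")
  case True
  then show ?thesis using coeff_mult_degree_sum by blast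
next
  case False
  then have "degree (p * q) < m + n"
    using assms degree_mult_le[of p q] by linarith
  moreover have "degree p < m \<or> degree q < n"
    using False assms by auto
  ultimately show ?thesis
    by (auto simp: coeff_eq_0)
qed

lemma coeff_taylor_rho_jk:
  assumes "j \<in> {1..N}" "k \<le> d j"
  shows "coeff (smult a (taylor_poly k y f) * rho_jk N c d j k) (dtot N d - 1) =
    a * poly ((pderiv ^^ k) f) y / fact k"
proof -
  have "coeff (smult a (taylor_poly k y f) * rho_jk N c d j k) (k + degree (rho_jk N c d j k))
      = a * poly ((pderiv ^^ k) f) y / fact k * lead_coeff (rho_jk N c d j k)"
    using degree_taylor_poly_le degree_smult_le
    by (subst coeff_mult_degree_le) (auto simp: coeff_taylor_poly_self intro: order.trans)
  moreover have "k + degree (rho_jk N c d j k) = dtot N d - 1"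
    using degree_rho_jk[of j N k d c, OF assms] by simp
  ultimately show ?thesis
    by (simp add: lead_coeff_rho_jk[of j N k d c, OF assms] del: mult_smult_left)
qed

section \<open>The Sobolev form and the connection formulas\<close>

locale laguerre_sobolev = laguerre_weight +
  fixes N :: nat and c :: "nat \<Rightarrow> real" and d :: "nat \<Rightarrow> nat" and lam :: "nat \<Rightarrow> nat \<Rightarrow> real"
begin

abbreviation "I \<equiv> I_plus N d lam"

sublocale sobolev: poly_inner_product "sobolev_ip \<alpha> N c d lam"
proof
  fix f g q :: "real poly" and a :: real
  show "sobolev_ip \<alpha> N c d lam (f + g) q = sobolev_ip \<alpha> N c d lam f q + sobolev_ip \<alpha> N c d lam g q"
    by (simp add: sobolev_ip_def add_left higher_pderiv_add distrib_left distrib_right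
        sum.distrib case_prod_unfold)
  show "sobolev_ip \<alpha> N c d lam (smult a f) q = a * sobolev_ip \<alpha> N c d lam f q"
    by (simp add: sobolev_ip_def smult_left higher_pderiv_smult distrib_left sum_distrib_left
        case_prod_unfold mult_ac)
  show "sobolev_ip \<alpha> N c d lam f g = sobolev_ip \<alpha> N c d lam g f"
    by (simp add: sobolev_ip_def commute[of f] case_prod_unfold mult_ac)
  assume "f \<noteq> 0"
  \<comment> \<open>Membership in \<open>I_plus\<close> includes \<open>lam j k > 0\<close>, so the
    discrete part is nonnegative.\<close>
  then show "sobolev_ip \<alpha> N c d lam f f > 0"
    unfolding sobolev_ip_def
    by (intro add_pos_nonneg pos sum_nonneg) (auto simp: I_plus_def mult.assoc)
qed

abbreviation S :: "nat \<Rightarrow> real poly" where "S \<equiv> sobolev \<alpha> N c d lam"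

lemma coeff_sobolev_self: "coeff (S n) n = 1"
  using sobolev.lead_coeff_monic_op[of n] by (simp add: sobolev_def sobolev.degree_monic_op)

lemma coeff_sobolev_diff_lag: "\<forall>i\<ge>n. coeff (S n - lag \<alpha> n) i = 0"
proof (intro allI impI)
  fix i assume "i \<ge> n"
  then show "coeff (S n - lag \<alpha> n) i = 0"
    using coeff_sobolev_self[of n]
    by (cases "i = n") (auto simp: coeff_lag_self coeff_lag_eq_0 sobolev_def
        sobolev.degree_monic_op coeff_eq_0)
qed

lemma sobolev_ip_lower:
  assumes "\<forall>i\<ge>n. coeff p i = 0"
  shows "sobolev_ip \<alpha> N c d lam (S n) p = 0"
  using assms sobolev.monic_op_orthogonal unfolding sobolev_def
  by (intro sobolev.orthogonal_lower[of n]) auto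

lemma poly_sobolev:
  "poly (S n) x = poly (lag \<alpha> n) x -
     (\<Sum>(j, k)\<in>I. lam j k * poly ((pderiv ^^ k) (S n)) (c j) * poly ((pderiv ^^ k) (kernel n x)) (c j))"
proof -
  define M where "M p = (\<Sum>(j, k)\<in>I. lam j k * poly ((pderiv ^^ k) (S n)) (c j)
      * poly ((pderiv ^^ k) p) (c j))" for p
  \<comment> \<open>For \<open>i < n\<close> the Sobolev pairing of \<open>S n\<close> and the
    Laguerre pairing of \<open>lag \<alpha> n\<close> with \<open>lag \<alpha> i\<close> both
    vanish, which leaves minus the discrete part \<open>M\<close>.\<close>
  have "laguerre_ip \<alpha> (S n - lag \<alpha> n) (lag \<alpha> i) = - M (lag \<alpha> i)" if "i < n" for i
    using that sobolev_ip_lower[of n "lag \<alpha> i"] ip_lag_lower[of n "lag \<alpha> i"]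
    by (simp add: diff_left M_def sobolev_ip_def coeff_lag_eq_0)
  then have "S n - lag \<alpha> n = (\<Sum>i<n. smult (- M (lag \<alpha> i) / h \<alpha> i) (lag \<alpha> i))"
    using lag_expansion[OF coeff_sobolev_diff_lag[of n]] by simp
  then have "S n = lag \<alpha> n + (\<Sum>i<n. smult (- M (lag \<alpha> i) / h \<alpha> i) (lag \<alpha> i))"
    by (simp add: algebra_simps)
  then have "poly (S n) x = poly (lag \<alpha> n) x - (\<Sum>i<n. poly (lag \<alpha> i) x / h \<alpha> i * M (lag \<alpha> i))"
    by (simp add: poly_sum sum_negf mult_ac)
  \<comment> \<open>\<open>M\<close> is linear, so it passes through the sum that defines the
    kernel.\<close>
  also have "(\<Sum>i<n. poly (lag \<alpha> i) x / h \<alpha> i * M (lag \<alpha> i)) = M (kernel n x)"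
    unfolding M_def kernel_def sum_distrib_left case_prod_unfold
    by (subst sum.swap) (simp add: higher_pderiv_sum higher_pderiv_smult poly_sum sum_distrib_left mult_ac)
  finally show ?thesis unfolding M_def .
qed

text \<open>In the Christoffel-Darboux formula the values at \<open>x\<close> are constants for the
  differentiation in \<open>y\<close>, so only the other factors turn into Taylor
  polynomials.\<close>

lemma higher_pderiv_kernel:
  assumes "n \<ge> 1"
  shows "(x - y) ^ Suc k * poly ((pderiv ^^ k) (kernel n x)) y =
    fact k / h \<alpha> (n - 1) *
      (poly (lag \<alpha> n) x * poly (taylor_poly k y (lag \<alpha> (n - 1))) x
       - poly (lag \<alpha> (n - 1)) x * poly (taylor_poly k y (lag \<alpha> n)) x)"
  unfolding higher_pderiv_linear_quotient[OF christoffel_darboux[OF assms]] poly_taylor_poly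
  by (simp add: higher_pderiv_diff higher_pderiv_smult sum_subtractf sum_distrib_left
      diff_divide_distrib algebra_simps)

lemma rho_mult_sobolev:
  assumes "n \<ge> 1"
  shows "rho N c d * S n = F2 \<alpha> N c d lam n * lag \<alpha> n + G2 \<alpha> N c d lam n * lag \<alpha> (n - 1)"
proof -
  have "poly (rho N c d * S n) x
      = poly (F2 \<alpha> N c d lam n * lag \<alpha> n + G2 \<alpha> N c d lam n * lag \<alpha> (n - 1)) x" for x
  proof -
    have summand: "poly (rho N c d) x * (lam j k * poly ((pderiv ^^ k) (S n)) (c j)
          * poly ((pderiv ^^ k) (kernel n x)) (c j))
        = mass_coeff \<alpha> N c d lam n j k * poly (rho_jk N c d j k) x *
          (poly (lag \<alpha> n) x * poly (taylor_poly k (c j) (lag \<alpha> (n - 1))) x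
           - poly (lag \<alpha> (n - 1)) x * poly (taylor_poly k (c j) (lag \<alpha> n)) x)"
      if "(j, k) \<in> I" for j k
    proof -
      have "j \<in> {1..N}" "k \<le> d j"
        using that by (auto simp: I_plus_def)
      \<comment> \<open>The power of \<open>x - c j\<close> split off from \<open>rho\<close> is the
        one that \<open>higher_pderiv_kernel\<close> requires.\<close>
      then have "poly (rho N c d) x = poly (rho_jk N c d j k) x * (x - c j) ^ Suc k"
        by (subst rho_eq_rho_jk_mult) (auto simp: algebra_simps)
      then have "poly (rho N c d) x * (lam j k * poly ((pderiv ^^ k) (S n)) (c j)
          * poly ((pderiv ^^ k) (kernel n x)) (c j))
          = poly (rho_jk N c d j k) x * lam j k * poly ((pderiv ^^ k) (S n)) (c j)
            * ((x - c j) ^ Suc k * poly ((pderiv ^^ k) (kernel n x)) (c j))"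
        by (simp only: mult_ac)
      then show ?thesis
        unfolding higher_pderiv_kernel[OF assms] by (simp add: mass_coeff_def mult_ac)
    qed
    have "poly (rho N c d * S n) x = poly (rho N c d) x * poly (lag \<alpha> n) x -
        (\<Sum>(j, k)\<in>I. poly (rho N c d) x * (lam j k * poly ((pderiv ^^ k) (S n)) (c j)
          * poly ((pderiv ^^ k) (kernel n x)) (c j)))"
      by (simp add: poly_sobolev[of n x] right_diff_distrib sum_distrib_left case_prod_unfold)
    also have "\<dots> = poly (rho N c d) x * poly (lag \<alpha> n) x -
        (\<Sum>(j, k)\<in>I. mass_coeff \<alpha> N c d lam n j k * poly (rho_jk N c d j k) x *
          (poly (lag \<alpha> n) x * poly (taylor_poly k (c j) (lag \<alpha> (n - 1))) x
           - poly (lag \<alpha> (n - 1)) x * poly (taylor_poly k (c j) (lag \<alpha> n)) x))"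
      using summand by (intro arg_cong2[where f = minus] sum.cong) auto
    also have "\<dots> = poly (F2 \<alpha> N c d lam n * lag \<alpha> n + G2 \<alpha> N c d lam n * lag \<alpha> (n - 1)) x"
    proof -
      define m where "m j k = mass_coeff \<alpha> N c d lam n j k * poly (rho_jk N c d j k) x" for j k
      define T where "T i j k = poly (taylor_poly k (c j) (lag \<alpha> i)) x" for i j k
      have "poly (F2 \<alpha> N c d lam n) x = poly (rho N c d) x - (\<Sum>(j, k)\<in>I. m j k * T (n - 1) j k)"
        by (simp add: F2_def laguerre_eq_lag poly_sum case_prod_unfold m_def T_def mult_ac)
      moreover have "poly (G2 \<alpha> N c d lam n) x = (\<Sum>(j, k)\<in>I. m j k * T n j k)"
        by (simp add: G2_def laguerre_eq_lag poly_sum case_prod_unfold m_def T_def mult_ac)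
      ultimately show ?thesis
        unfolding m_def[symmetric] T_def[symmetric] poly_add poly_mult
        by (simp add: left_diff_distrib right_diff_distrib sum_subtractf sum_distrib_left
            sum_distrib_right case_prod_unfold mult_ac)
    qed
    finally show ?thesis .
  qed
  then show ?thesis
    using poly_eq_poly_eq_iff by blast
qed

lemma pderiv_rho_mult_sobolev:
  assumes "n \<ge> 1"
  shows "[:0, 1:] * pderiv (rho N c d * S n) =
    F3 \<alpha> N c d lam n * lag \<alpha> n + G3 \<alpha> N c d lam n * lag \<alpha> (n - 1)"
proof -
  let ?X = "[:0, 1:] :: real poly"
  let ?F = "F2 \<alpha> N c d lam n" and ?G = "G2 \<alpha> N c d lam n"
  have eq: "[:- (real n + \<alpha>), 1:] = - [:real n + \<alpha>, - 1:]"
    by simp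
  \<comment> \<open>Pure ring algebra, stated for variables so that simplification does not unfold
    the linear polynomials; \<open>B\<close> stands for
    \<open>[:real n + \<alpha>, - 1:]\<close>.\<close>
  have rearrange: "X * F' * L + F * (smult a L + smult b M) + (X * G' * M + G * (- B * M - L))
      = (X * F' + smult a F - G) * L + (X * G' + smult b F - B * G) * M"
    for X F F' G G' L M B :: "real poly" and a b :: real
    by (simp add: algebra_simps)
  have "?X * pderiv (rho N c d * S n)
      = ?X * pderiv ?F * lag \<alpha> n + ?F * (?X * pderiv (lag \<alpha> n))
        + (?X * pderiv ?G * lag \<alpha> (n - 1) + ?G * (?X * pderiv (lag \<alpha> (n - 1))))"
    unfolding rho_mult_sobolev[OF assms] pderiv_add pderiv_mult by (simp only: algebra_simps)
  also have "\<dots> = F3 \<alpha> N c d lam n * lag \<alpha> n + G3 \<alpha> N c d lam n * lag \<alpha> (n - 1)"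
    unfolding lag_structure[OF assms] lag_structure_pred[OF assms] F3_def G3_def eq
    by (rule rearrange)
  finally show ?thesis .
qed

section \<open>Leading terms of \<open>F2\<close> and \<open>G2\<close>\<close>

lemma degree_G2: "degree (G2 \<alpha> N c d lam n) \<le> dtot N d - 1"
  unfolding G2_def
  by (intro degree_sum_le finite_I_plus)
    (auto simp del: mult_smult_left One_nat_def intro!: degree_taylor_rho_jk_le simp: I_plus_def)

text \<open>The factor \<open>fact k\<close> in \<open>mass_coeff\<close> cancels against the
  denominator of the top Taylor coefficient, which leaves the sum in \<open>sigma_n\<close>.\<close>

lemma coeff_G2: "coeff (G2 \<alpha> N c d lam n) (dtot N d - 1) = sigma_n \<alpha> N c d lam n"
proof -
  have "coeff (G2 \<alpha> N c d lam n) (dtot N d - 1) = (\<Sum>(j, k)\<in>I.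
      mass_coeff \<alpha> N c d lam n j k * poly ((pderiv ^^ k) (lag \<alpha> n)) (c j) / fact k)"
    unfolding G2_def coeff_sum laguerre_eq_lag
  proof (intro sum.cong refl, clarify)
    fix j k assume "(j, k) \<in> I"
    then have "j \<in> {1..N}" "k \<le> d j"
      by (auto simp: I_plus_def)
    then show "coeff (smult (mass_coeff \<alpha> N c d lam n j k) (taylor_poly k (c j) (lag \<alpha> n))
        * rho_jk N c d j k) (dtot N d - 1)
      = mass_coeff \<alpha> N c d lam n j k * poly ((pderiv ^^ k) (lag \<alpha> n)) (c j) / fact k"
      by (rule coeff_taylor_rho_jk)
  qed
  also have "\<dots> = (\<Sum>(j, k)\<in>I. 1 / h \<alpha> (n - 1) *
      (lam j k * poly ((pderiv ^^ k) (S n)) (c j) * poly ((pderiv ^^ k) (lag \<alpha> n)) (c j)))"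
    unfolding mass_coeff_def by (intro sum.cong refl) (auto simp: field_simps)
  also have "\<dots> = sigma_n \<alpha> N c d lam n"
    by (simp only: sigma_n_def laguerre_eq_lag sum_distrib_left case_prod_unfold)
  finally show ?thesis .
qed

text \<open>Gives \<open>F2\<close> the leading term of \<open>rho\<close>, as
  \<open>dtot N d > 0\<close> for \<open>N \<ge> 1\<close>.\<close>

lemma degree_rho_diff_F2: "degree (rho N c d - F2 \<alpha> N c d lam n) \<le> dtot N d - 1"
proof -
  let ?s = "\<Sum>(j, k)\<in>I. smult (mass_coeff \<alpha> N c d lam n j k)
      (taylor_poly k (c j) (laguerre \<alpha> (n - 1))) * rho_jk N c d j k"
  have "rho N c d - F2 \<alpha> N c d lam n = ?s"
    by (simp only: F2_def diff_diff_eq2 add_diff_cancel_left')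
  moreover have "degree ?s \<le> dtot N d - 1"
    by (intro degree_sum_le finite_I_plus)
      (auto simp del: mult_smult_left One_nat_def intro!: degree_taylor_rho_jk_le simp: I_plus_def)
  ultimately show ?thesis by simp
qed

section \<open>The sign of \<open>sigma_n\<close>\<close>

lemma sigma_n_sum_of_squares:
  "h \<alpha> (n - 1) * sigma_n \<alpha> N c d lam n =
     laguerre_ip \<alpha> (S n - lag \<alpha> n) (S n - lag \<alpha> n)
     + (\<Sum>(j, k)\<in>I. lam j k * (poly ((pderiv ^^ k) (S n)) (c j))\<^sup>2)"
proof -
  let ?r = "S n - lag \<alpha> n"
  have "h \<alpha> (n - 1) * sigma_n \<alpha> N c d lam n = (\<Sum>(j, k)\<in>I.
      lam j k * poly ((pderiv ^^ k) (S n)) (c j) * poly ((pderiv ^^ k) (lag \<alpha> n)) (c j))"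
    using h_pos[OF alpha, of "n - 1"] by (simp add: sigma_n_def laguerre_eq_lag)
  also have "\<dots> = sobolev_ip \<alpha> N c d lam (S n) (lag \<alpha> n) - laguerre_ip \<alpha> (S n) (lag \<alpha> n)"
    by (simp add: sobolev_ip_def)
  \<comment> \<open>Both polynomials are monic of degree \<open>n\<close>, so \<open>S n\<close> is
    Sobolev-orthogonal to their difference.\<close>
  also have "sobolev_ip \<alpha> N c d lam (S n) (lag \<alpha> n) = sobolev_ip \<alpha> N c d lam (S n) (S n)"
    using sobolev_ip_lower[OF coeff_sobolev_diff_lag[of n]] by (simp add: sobolev.diff_right)
  also have "\<dots> = laguerre_ip \<alpha> (S n) (S n) + (\<Sum>(j, k)\<in>I. lam j k * (poly ((pderiv ^^ k) (S n)) (c j))\<^sup>2)"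
    by (simp add: sobolev_ip_def power2_eq_square mult.assoc)
  \<comment> \<open>Pythagoras: \<open>lag \<alpha> n\<close> is orthogonal to the lower-degree
    difference \<open>?r\<close>.\<close>
  also have "laguerre_ip \<alpha> (S n) (S n) = laguerre_ip \<alpha> (S n) (lag \<alpha> n) + laguerre_ip \<alpha> ?r ?r"
    using ip_lag_lower[OF coeff_sobolev_diff_lag[of n]] commute[of "lag \<alpha> n" "S n"]
    by (simp add: diff_right diff_left)
  finally show ?thesis by simp
qed

text \<open>Covers also the case that all masses have order above \<open>n\<close>; this keeps the
  leading coefficient of \<open>G3\<close> positive for every \<open>n \<ge> 1\<close>.\<close>

lemma sigma_n_nonneg: "sigma_n \<alpha> N c d lam n \<ge> 0"
proof -
  have "laguerre_ip \<alpha> p p \<ge> 0" for p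
    using pos[of p] zero_left by (cases "p = 0") auto
  then have "h \<alpha> (n - 1) * sigma_n \<alpha> N c d lam n \<ge> 0"
    unfolding sigma_n_sum_of_squares by (intro add_nonneg_nonneg sum_nonneg) (auto simp: I_plus_def)
  then show ?thesis
    using h_pos[OF alpha, of "n - 1"] by (simp add: zero_le_mult_iff)
qed

lemma sigma_n_pos:
  assumes "(j, k) \<in> I" "k \<le> n" "c j < 0"
  shows "sigma_n \<alpha> N c d lam n > 0"
proof -
  let ?Q = "\<Sum>(j, k)\<in>I. lam j k * (poly ((pderiv ^^ k) (S n)) (c j))\<^sup>2"
  have Q: "?Q \<ge> 0"
    by (intro sum_nonneg) (auto simp: I_plus_def)
  have "h \<alpha> (n - 1) * sigma_n \<alpha> N c d lam n > 0"
  proof (cases "S n = lag \<alpha> n")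
    case True
    \<comment> \<open>The norm of the difference is 0 here, so positivity comes from the mass at
      \<open>(j, k)\<close>.\<close>
    have "poly ((pderiv ^^ k) (S n)) (c j) \<noteq> 0"
      unfolding True using assms by (intro higher_pderiv_lag_nonzero)
    then have "?Q > 0"
      using assms finite_I_plus by (intro sum_pos2[of _ "(j, k)"]) (auto simp: I_plus_def)
    then show ?thesis
      unfolding sigma_n_sum_of_squares by (simp add: True zero_left)
  next
    case False
    then show ?thesis
      unfolding sigma_n_sum_of_squares using Q pos[of "S n - lag \<alpha> n"] by simp
  qed
  then show ?thesis
    using h_pos[OF alpha, of "n - 1"] by (simp add: zero_less_mult_iff)
qed

section \<open>The rational functions \<open>F1\<close> and \<open>G1\<close>\<close>

text \<open>Equality of fractions is cross-multiplication, which here is the factorization of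
  \<open>rho\<close> by \<open>rho_jk\<close>.\<close>

lemma rho_mult_Fract:
  assumes "(j, k) \<in> I"
  shows "to_fract (rho N c d) * Fract p ([:- c j, 1:] ^ (k + 1)) = to_fract (p * rho_jk N c d j k)"
proof -
  have "rho N c d = rho_jk N c d j k * [:- c j, 1:] ^ (k + 1)"
    using assms by (intro rho_eq_rho_jk_mult) (auto simp: I_plus_def)
  then show ?thesis
    by (simp add: to_fract_def eq_fract mult_ac del: power_Suc)
qed

lemma to_fract_F2: "to_fract (F2 \<alpha> N c d lam n) = to_fract (rho N c d) * F1 \<alpha> N c d lam n"
  unfolding F2_def F1_def to_fract_diff right_diff_distrib mult_1_right to_fract_sum sum_distrib_left
  by (intro arg_cong2[where f = minus] refl sum.cong, clarify)
    (rule rho_mult_Fract[symmetric])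

lemma to_fract_G2: "to_fract (G2 \<alpha> N c d lam n) = to_fract (rho N c d) * G1 \<alpha> N c d lam n"
  unfolding G2_def G1_def to_fract_sum sum_distrib_left
  by (intro refl sum.cong, clarify)
    (rule rho_mult_Fract[symmetric])

end

lemma DgCo_eqI:
  assumes "degree p \<le> n" "coeff p n = a" "a \<noteq> 0"
  shows "DgCo p = (n, a)"
  using assms le_degree[of p n] by (simp add: DgCo_def)

text \<open>The claims on \<open>G2\<close> and on the sign of \<open>sigma_n\<close> have the
  premise that some mass has \<open>k \<le> n\<close>; otherwise all derivatives in
  \<open>sigma_n\<close> vanish.\<close>

theorem lemma3p1:
  fixes \<alpha> :: real and N n :: nat and c :: "nat \<Rightarrow> real" and d :: "nat \<Rightarrow> nat"
    and lam :: "nat \<Rightarrow> nat \<Rightarrow> real"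
  assumes "\<alpha> > - 1"
    and "N \<ge> 1"
    and "\<And>j. j \<in> {1..N} \<Longrightarrow> c j < 0"
    and "inj_on c {1..N}"
    and "mono_on {1..N} d"
    and "\<And>j k. j \<in> {1..N} \<Longrightarrow> k \<le> d j \<Longrightarrow> lam j k \<ge> 0"
    and "\<And>j. j \<in> {1..N} \<Longrightarrow> lam j (d j) > 0"
    and "n \<ge> 1"
  shows
    "rho N c d * sobolev \<alpha> N c d lam n
       = F2 \<alpha> N c d lam n * laguerre \<alpha> n + G2 \<alpha> N c d lam n * laguerre \<alpha> (n - 1)
     \<and> [:0, 1:] * pderiv (rho N c d * sobolev \<alpha> N c d lam n)
       = F3 \<alpha> N c d lam n * laguerre \<alpha> n + G3 \<alpha> N c d lam n * laguerre \<alpha> (n - 1)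
     \<and> to_fract (F2 \<alpha> N c d lam n) = to_fract (rho N c d) * F1 \<alpha> N c d lam n
     \<and> to_fract (G2 \<alpha> N c d lam n) = to_fract (rho N c d) * G1 \<alpha> N c d lam n
     \<and> DgCo (F2 \<alpha> N c d lam n) = (dtot N d, 1)
     \<and> DgCo (F3 \<alpha> N c d lam n) = (dtot N d, real (dtot N d) + real n)
     \<and> DgCo (G3 \<alpha> N c d lam n) = (dtot N d, gam \<alpha> n + sigma_n \<alpha> N c d lam n)
     \<and> ((\<exists>(j, k) \<in> I_plus N d lam. k \<le> n) \<longrightarrow>
          DgCo (G2 \<alpha> N c d lam n) = (dtot N d - 1, sigma_n \<alpha> N c d lam n)
          \<and> sigma_n \<alpha> N c d lam n > 0)"
proof -
  interpret laguerre_sobolev \<alpha> N c d lam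
    by unfold_locales fact
  let ?D = "dtot N d" and ?F = "F2 \<alpha> N c d lam n" and ?G = "G2 \<alpha> N c d lam n"
  \<comment> \<open>Makes \<open>?D - 1\<close> a genuine predecessor, so that degree at most
    \<open>?D - 1\<close> means below \<open>?D\<close>.\<close>
  have "dtot N d > 0"
    using assms(2) unfolding dtot_def by (intro sum_pos) auto
  then obtain m where D: "?D = Suc m"
    using gr0_conv_Suc by blast
  have coeff_X: "coeff ([:0, 1:] * ?G) i = (if i = 0 then 0 else coeff ?G (i - 1))" for i
    by (cases i) auto
  have coeff_XD: "coeff ([:0, 1:] * pderiv p) i = real i * coeff p i" for p i
    by (cases i) (simp_all add: coeff_pderiv)
  have G: "coeff ?G i = 0" if "i \<ge> ?D" for i
    using that degree_G2[of n] D by (intro coeff_eq_0) auto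
  have F: "coeff ?F i = (if i = ?D then 1 else 0)" if "i \<ge> ?D" for i
  proof -
    have "coeff (rho N c d - ?F) i = 0"
      using that degree_rho_diff_F2[of n] D by (intro coeff_eq_0) auto
    then show ?thesis
      using that lead_coeff_rho[of N c d] coeff_eq_0[of "rho N c d" i] by (auto simp: degree_rho)
  qed
  have "DgCo ?F = (?D, 1)"
    by (intro DgCo_eqI degree_le) (auto simp: F)
  \<comment> \<open>The derivative term contributes \<open>?D\<close> and the multiple of
    \<open>F2\<close> contributes \<open>n\<close>; \<open>G2\<close> has lower degree.\<close>
  moreover have "DgCo (F3 \<alpha> N c d lam n) = (?D, real ?D + real n)"
    using assms(8)
    by (intro DgCo_eqI degree_le) (auto simp: F3_def coeff_XD F G simp del: mult_pCons_left)
  moreover have "DgCo (G3 \<alpha> N c d lam n) = (?D, gam \<alpha> n + sigma_n \<alpha> N c d lam n)"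
  proof (intro DgCo_eqI degree_le)
    \<comment> \<open>Multiplication by \<open>[:0, 1:]\<close> moves the coefficient
      \<open>sigma_n\<close> of \<open>G2\<close> to position \<open>?D\<close>, where it meets
      \<open>gam \<alpha> n\<close> from \<open>F2\<close>.\<close>
    have eq: "[:real n + \<alpha>, - 1:] * ?G = smult (real n + \<alpha>) ?G - [:0, 1:] * ?G"
      by simp
    show "\<forall>i>?D. coeff (G3 \<alpha> N c d lam n) i = 0"
      unfolding G3_def eq by (auto simp: coeff_X coeff_XD F G simp del: mult_pCons_left)
    show "coeff (G3 \<alpha> N c d lam n) ?D = gam \<alpha> n + sigma_n \<alpha> N c d lam n"
      unfolding G3_def eq using coeff_G2[of n] D
      by (auto simp: coeff_X coeff_XD F G simp del: mult_pCons_left)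
    have "gam \<alpha> n > 0"
      using assms(1,8) by (simp add: gam_def)
    then show "gam \<alpha> n + sigma_n \<alpha> N c d lam n \<noteq> 0"
      using sigma_n_nonneg[of n] by simp
  qed
  moreover have "DgCo ?G = (?D - 1, sigma_n \<alpha> N c d lam n) \<and> sigma_n \<alpha> N c d lam n > 0"
    if "\<exists>(j, k) \<in> I_plus N d lam. k \<le> n"
  proof -
    have "sigma_n \<alpha> N c d lam n > 0"
      using that assms(3) by (auto simp: I_plus_def intro!: sigma_n_pos)
    then show ?thesis
      using degree_G2 coeff_G2 by (auto intro!: DgCo_eqI)
  qed
  ultimately show ?thesis
    using rho_mult_sobolev[OF assms(8)] pderiv_rho_mult_sobolev[OF assms(8)] to_fract_F2 to_fract_G2
    unfolding laguerre_eq_lag by blast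
qed

end
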